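(* Let $\mathcal{X}\subset\mathbb{R}^d$ be nonempty, compact and convex, let $f:\mathbb{R}^d\to\mathbb{R}$ be given by $f(x)=\mathbb{E}[F(x,\zeta)]$, where $\zeta$ is a random variable and $F(\cdot,\zeta)$ is convex for every realization of $\zeta$ (so $f$ is convex), and suppose there is $M>0$ such that for all $x,y\in\mathcal{X}$, all $g(x)\in\partial f(x)$ and all $g(y)\in\partial f(y)$, $$\langle g(x)-g(y),\,x-y\rangle\ge M\|x-y\|^2.$$ Let $x^\ast$ be the unique minimizer of $f$ over $\mathcal{X}$, let $G>0$, and put $\widehat{\mathcal{N}}_{\mathcal{X}}(x)=\{\nu\in\mathcal{N}_{\mathcal{X}}(x):\|\nu\|\le G\}$ for $x\in\mathcal{X}$. Then the system $$\dot x(t)\in-\big(\partial f(x(t))+\widehat{\mathcal{N}}_{\mathcal{X}}(x(t))+\bar B(0,\epsilon)\big)$$ is input-to-state stable with respect to $x^\ast$: there exist $\beta\in\mathcal{KL}$ and $\gamma\in\mathcal{K}_\infty$ such that, for every $\epsilon\ge 0$ and every Carathéodory solution $x:[0,\infty)\to\mathcal{X}$ of this differential inclusion with $x(0)\in\mathcal{X}$, $$\|x(t)-x^\ast\|\le\beta(\|x(0)-x^\ast\|,t)+\gamma(\epsilon)\qquad\text{for all } t\ge0.$$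
   Context: $\|\cdot\|$ is the Euclidean norm and $\bar B(0,\epsilon)$ the closed ball of radius $\epsilon$ centered at the origin; sums of sets are Minkowski sums. $\partial f(x)$ is the convex subdifferential of $f$ at $x$. The normal cone to $\mathcal{X}$ at $x\in\mathcal{X}$ is $\mathcal{N}_{\mathcal{X}}(x)=\{v\in\mathbb{R}^d: v^\top(y-x)\le0\ \ \forall y\in\mathcal{X}\}$. In the paper, $G$ is a uniform bound on the norms of the stochastic subgradients used by a projected stochastic subgradient method, and $\epsilon$ is the bound on their bias. A Carathéodory solution is a locally absolutely continuous function satisfying the differential inclusion for almost every $t\ge 0$; since the right-hand side is only defined on $\mathcal{X}$, solutions take values in $\mathcal{X}$. A function $\gamma:[0,\infty)\to[0,\infty)$ is of class $\mathcal{K}_\infty$ if it is continuous, strictly increasing, unbounded and $\gamma(0)=0$; class $\mathcal{K}$ drops unboundedness. A function $\beta:[0,\infty)^2\to[0,\infty)$ is of class $\mathcal{KL}$ if it is continuous, $\beta(\cdot,t)$ is of class $\mathcal{K}$ for each fixed $t$, and $\beta(r,\cdot)$ is nonincreasing with $\beta(r,t)\to0$ as $t\to\infty$ for each fixed $r$. *)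

theory Defs
  imports "HOL-Probability.Probability"
begin

definition subdifferential :: "('a::real_inner \<Rightarrow> real) \<Rightarrow> 'a \<Rightarrow> 'a set" where
  "subdifferential f x = {g. \<forall>y. f y \<ge> f x + g \<bullet> (y - x)}"

definition normal_cone :: "'a::real_inner set \<Rightarrow> 'a \<Rightarrow> 'a set" where
  "normal_cone X x = {v. \<forall>y\<in>X. v \<bullet> (y - x) \<le> 0}"

definition truncated_normal_cone :: "real \<Rightarrow> 'a::real_inner set \<Rightarrow> 'a \<Rightarrow> 'a set" where
  "truncated_normal_cone G X x = {v \<in> normal_cone X x. norm v \<le> G}"

text \<open>
  Here \<open>+\<close> on sets is the Minkowski sum. The pointwise negation of a set is the image under
  \<open>uminus\<close>, since prefix minus on sets denotes the complement.
\<close>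

definition perturbed_field ::
    "('a::real_inner \<Rightarrow> real) \<Rightarrow> real \<Rightarrow> 'a set \<Rightarrow> real \<Rightarrow> 'a \<Rightarrow> 'a set" where
  "perturbed_field f G X \<epsilon> x =
     uminus ` (subdifferential f x + truncated_normal_cone G X x + cball 0 \<epsilon>)"

text \<open>
  The usual \<open>\<epsilon>\<close>-\<open>\<delta>\<close> condition. A finite family \<open>D\<close> with \<open>D division_of \<Union>D\<close> consists of
  nonempty compact intervals with pairwise disjoint interiors, and \<open>Inf K\<close>, \<open>Sup K\<close> are
  the endpoints of such an interval \<open>K\<close>.
\<close>

definition absolutely_continuous_on :: "real \<Rightarrow> real \<Rightarrow> (real \<Rightarrow> 'a::real_normed_vector) \<Rightarrow> bool" where
  "absolutely_continuous_on a b x \<longleftrightarrow>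
     (\<forall>e>0. \<exists>\<delta>>0. \<forall>D. D division_of \<Union>D \<and> \<Union>D \<subseteq> {a..b} \<and> (\<Sum>K\<in>D. Sup K - Inf K) < \<delta>
        \<longrightarrow> (\<Sum>K\<in>D. norm (x (Sup K) - x (Inf K))) < e)"

text \<open>Curves on \<open>[0,\<infinity>)\<close> are total functions whose values at negative times are irrelevant.\<close>

definition caratheodory_solution ::
    "('a::euclidean_space \<Rightarrow> 'a set) \<Rightarrow> 'a set \<Rightarrow> (real \<Rightarrow> 'a) \<Rightarrow> bool" where
  "caratheodory_solution \<Phi> X x \<longleftrightarrow>
     (\<forall>t\<ge>0. x t \<in> X) \<and>
     (\<forall>a b. 0 \<le> a \<and> a \<le> b \<longrightarrow> absolutely_continuous_on a b x) \<and>
     (AE t in lborel. t \<ge> 0 \<longrightarrow>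
        (\<exists>v\<in>\<Phi> (x t). (x has_vector_derivative v) (at t within {0..})))"

definition class_K :: "(real \<Rightarrow> real) \<Rightarrow> bool" where
  "class_K \<gamma> \<longleftrightarrow> \<gamma> \<in> {0..} \<rightarrow> {0..} \<and> continuous_on {0..} \<gamma> \<and> strict_mono_on {0..} \<gamma> \<and> \<gamma> 0 = 0"

definition class_K_infinity :: "(real \<Rightarrow> real) \<Rightarrow> bool" where
  "class_K_infinity \<gamma> \<longleftrightarrow> class_K \<gamma> \<and> \<not> bdd_above (\<gamma> ` {0..})"

definition class_KL :: "(real \<Rightarrow> real \<Rightarrow> real) \<Rightarrow> bool" where
  "class_KL \<beta> \<longleftrightarrow>
     continuous_on ({0..} \<times> {0..}) (\<lambda>(r, t). \<beta> r t) \<and>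
     (\<forall>t\<ge>0. class_K (\<lambda>r. \<beta> r t)) \<and>
     (\<forall>r\<ge>0. antimono_on {0..} (\<beta> r) \<and> (\<beta> r \<longlongrightarrow> 0) at_top)"

text \<open>
  The parameter \<open>\<Phi>\<close> is a family of set-valued fields indexed by the disturbance bound
  \<open>\<epsilon>\<close>; the comparison functions may depend on neither \<open>\<epsilon>\<close> nor the solution.
\<close>

definition input_to_state_stable ::
    "(real \<Rightarrow> 'a::euclidean_space \<Rightarrow> 'a set) \<Rightarrow> 'a set \<Rightarrow> 'a \<Rightarrow> bool" where
  "input_to_state_stable \<Phi> X xs \<longleftrightarrow>
     (\<exists>\<beta> \<gamma>. class_KL \<beta> \<and> class_K_infinity \<gamma> \<and>
        (\<forall>\<epsilon>\<ge>0. \<forall>x. caratheodory_solution (\<Phi> \<epsilon>) X x \<and> x 0 \<in> X \<longrightarrow>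
           (\<forall>t\<ge>0. norm (x t - xs) \<le> \<beta> (norm (x 0 - xs)) t + \<gamma> \<epsilon>)))"

end

theory Submission
  imports Defs "HOL-Real_Asymp.Real_Asymp"
begin

text \<open>
  Let \<open>V t = (norm (x t - xs))\<^sup>2\<close>. Strong monotonicity and optimality of \<open>xs\<close> give
  \<open>g \<bullet> (x - xs) \<ge> M / 2 * (norm (x - xs))\<^sup>2\<close> for every subgradient \<open>g\<close> at \<open>x\<close>: comparing \<open>g\<close>
  with a subgradient at the midpoint of \<open>x\<close> and \<open>xs\<close> avoids the first-order optimality condition
  and costs only a factor 2. Normal vectors contribute a term of the right sign, so Young's
  inequality on the perturbation yields \<open>V' \<le> - (M / 2) * (V - (2 * \<epsilon> / M)\<^sup>2)\<close> almost everywhere,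
  and \<open>exp (M / 2 * t) * (V t - (2 * \<epsilon> / M)\<^sup>2)\<close> is nonincreasing. Taking square roots gives
  \<open>\<beta> r t = exp (- (M / 4) * t) * r\<close> and \<open>\<gamma> \<epsilon> = 2 * \<epsilon> / M\<close>.
\<close>

section \<open>Subgradients of convex functions and growth at the minimizer\<close>

text \<open>A hyperplane separating \<open>(x, f x)\<close> from the strict epigraph of
  \<open>f\<close> cannot be vertical, because \<open>f\<close> is finite on the whole space.
  Dividing its normal by the vertical component \<open>c\<close> yields the slope of an affine
  minorant touching \<open>f\<close> at \<open>x\<close>.\<close>

lemma subgradient_exists:
  fixes f :: "'a::euclidean_space \<Rightarrow> real"
  assumes f: "convex_on UNIV f"
  shows "subdifferential f x \<noteq> {}"
proof -
  let ?T = "{(y, r). f y < r}"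
  have "convex ?T"
    unfolding convex_alt
  proof clarsimp
    fix y z :: 'a and r s u :: real
    assume *: "f y < r" "f z < s" "0 \<le> u" "u \<le> 1"
    have "f ((1 - u) *\<^sub>R y + u *\<^sub>R z) \<le> (1 - u) * f y + u * f z"
      using convex_onD[OF f] * by simp
    also have "\<dots> < (1 - u) * r + u * s"
    \<comment> \<open>The strict inequality is taken from the second summand, which vanishes for
      \<open>u = 0\<close>; there it comes from \<open>f y < r\<close>.\<close>
    proof (cases "u = 0")
      case False
      with * show ?thesis
        by (intro add_le_less_mono mult_left_mono mult_strict_left_mono) auto
    qed (use * in simp)
    finally show "f ((1 - u) *\<^sub>R y + u *\<^sub>R z) < (1 - u) * r + u * s" .
  qed
  moreover have "(x, f x + 1) \<in> ?T" by simp
  then have "?T \<noteq> {}" by blast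
  ultimately obtain a b
    where a: "a \<noteq> 0" "a \<bullet> (x, f x) \<le> b" "\<And>z. z \<in> ?T \<Longrightarrow> b \<le> a \<bullet> z"
    using separating_hyperplane_sets[of "{(x, f x)}" ?T] by auto
  obtain u c where uc: "a = (u, c)" by (cases a)
  have sep: "u \<bullet> x + c * f x \<le> u \<bullet> y + c * r" if "f y < r" for y r
    using a(2) a(3)[of "(y, r)"] that uc by simp
  \<comment> \<open>If \<open>c = 0\<close>, the separation restricts only the first component, and
    moving from \<open>x\<close> in direction \<open>- u\<close> forces \<open>u = 0\<close>, so
    that \<open>a = 0\<close>.\<close>
  have "c \<noteq> 0"
  proof
    assume "c = 0"
    then have "u \<bullet> x \<le> u \<bullet> (x - u)"
      using sep[of "x - u" "f (x - u) + 1"] by simp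
    then have "u \<bullet> u \<le> 0" by (simp add: inner_diff_right)
    then have "u = 0" using inner_gt_zero_iff[of u] by linarith
    with \<open>c = 0\<close> a(1) uc show False by (simp add: prod_eq_iff)
  qed
  moreover have "0 \<le> c"
    using sep[of x "f x + 1"] by (simp add: algebra_simps)
  ultimately have "0 < c" by simp
  \<comment> \<open>The point \<open>(y, f y)\<close> is not in the strict epigraph, so it is
    approached from above through \<open>(y, f y + e)\<close>.\<close>
  have "f y \<ge> f x + ((- 1 / c) *\<^sub>R u) \<bullet> (y - x)" for y
  proof (rule field_le_epsilon)
    fix e :: real
    assume "0 < e"
    then have "u \<bullet> x + c * f x \<le> u \<bullet> y + c * (f y + e)"
      by (intro sep) simp
    with \<open>0 < c\<close> show "f x + ((- 1 / c) *\<^sub>R u) \<bullet> (y - x) \<le> f y + e"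
      by (simp add: field_simps inner_diff_right)
  qed
  then have "(- 1 / c) *\<^sub>R u \<in> subdifferential f x"
    by (simp add: subdifferential_def)
  then show ?thesis by blast
qed

lemma convex_on_expectation:
  fixes F :: "'a::real_vector \<Rightarrow> 'z \<Rightarrow> real"
  assumes "\<And>x. integrable P (\<lambda>\<omega>. F x (\<zeta> \<omega>))"
    and "\<And>\<omega>. \<omega> \<in> space P \<Longrightarrow> convex_on UNIV (\<lambda>x. F x (\<zeta> \<omega>))"
  shows "convex_on UNIV (\<lambda>x. LINT \<omega>|P. F x (\<zeta> \<omega>))"
proof (rule convex_onI)
  fix t :: real and x y :: 'a
  assume "0 < t" "t < 1"
  then have "(LINT \<omega>|P. F ((1 - t) *\<^sub>R x + t *\<^sub>R y) (\<zeta> \<omega>))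
      \<le> (LINT \<omega>|P. (1 - t) * F x (\<zeta> \<omega>) + t * F y (\<zeta> \<omega>))"
    using assms by (intro integral_mono) (auto intro!: convex_onD[OF assms(2)])
  then show "(LINT \<omega>|P. F ((1 - t) *\<^sub>R x + t *\<^sub>R y) (\<zeta> \<omega>))
      \<le> (1 - t) * (LINT \<omega>|P. F x (\<zeta> \<omega>)) + t * (LINT \<omega>|P. F y (\<zeta> \<omega>))"
    using assms(1) by simp
qed simp

text \<open>At \<open>xs\<close> itself only some subgradients need to satisfy the optimality
  inequality. At the midpoint every one does: \<open>f xs \<le> f m\<close> and the subgradient
  inequality give \<open>h \<bullet> (x - xs) \<ge> 0\<close>.\<close>

lemma subgradient_at_minimizer_growth:
  fixes f :: "'a::euclidean_space \<Rightarrow> real"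
  assumes f: "convex_on UNIV f" and X: "convex X"
    and mono: "\<And>x y g h. x \<in> X \<Longrightarrow> y \<in> X \<Longrightarrow> g \<in> subdifferential f x \<Longrightarrow> h \<in> subdifferential f y
           \<Longrightarrow> (g - h) \<bullet> (x - y) \<ge> M * (norm (x - y))\<^sup>2"
    and xs: "is_arg_min f (\<lambda>x. x \<in> X) xs"
    and x: "x \<in> X" and g: "g \<in> subdifferential f x"
  shows "g \<bullet> (x - xs) \<ge> M / 2 * (norm (x - xs))\<^sup>2"
proof -
  define m where "m = (1 / 2) *\<^sub>R (x + xs)"
  have xs': "xs \<in> X" "\<And>y. y \<in> X \<Longrightarrow> f xs \<le> f y"
    using xs by (auto simp: is_arg_min_linorder)
  then have m: "m \<in> X"
    using convexD[OF X x xs'(1), of "1/2" "1/2"] by (simp add: m_def scaleR_add_right)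
  obtain h where h: "h \<in> subdifferential f m"
    using subgradient_exists[OF f] by blast
  have half: "x - m = (1 / 2) *\<^sub>R (x - xs)" "xs - m = - ((1 / 2) *\<^sub>R (x - xs))"
    unfolding m_def using scaleR_half_double[of x] scaleR_half_double[of xs]
    by (simp_all add: algebra_simps flip: scaleR_add_left)
  have "f xs \<ge> f m + h \<bullet> (xs - m)"
    using h by (simp add: subdifferential_def)
  with xs'(2)[OF m] have "h \<bullet> (x - xs) \<ge> 0"
    unfolding half by simp
  moreover have "(g - h) \<bullet> (x - m) \<ge> M * (norm (x - m))\<^sup>2"
    by (rule mono[OF x m g h])
  ultimately show ?thesis
    \<comment> \<open>The halved displacement enters linearly on the left and quadratically on the
      right, which turns \<open>M\<close> into \<open>M / 2\<close>.\<close>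
    unfolding half by (simp add: inner_diff_left power_divide)
qed

text \<open>A subgradient \<open>h\<close> at the midpoint \<open>m\<close> is squeezed: growth away
  from the minimizer \<open>y\<close> makes \<open>h \<bullet> (m - y)\<close> at least a multiple
  of the squared distance, while \<open>f x \<le> f m\<close> makes
  \<open>h \<bullet> (x - m)\<close> nonpositive, and \<open>x - m = m - y\<close>.\<close>

lemma minimizer_unique:
  fixes f :: "'a::euclidean_space \<Rightarrow> real"
  assumes f: "convex_on UNIV f" and X: "convex X" and "M > 0"
    and mono: "\<And>x y g h. x \<in> X \<Longrightarrow> y \<in> X \<Longrightarrow> g \<in> subdifferential f x \<Longrightarrow> h \<in> subdifferential f y
           \<Longrightarrow> (g - h) \<bullet> (x - y) \<ge> M * (norm (x - y))\<^sup>2"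
    and x: "is_arg_min f (\<lambda>x. x \<in> X) x" and y: "is_arg_min f (\<lambda>x. x \<in> X) y"
  shows "x = y"
proof -
  define m where "m = (1 / 2) *\<^sub>R (x + y)"
  have xy: "x \<in> X" "y \<in> X" "\<And>z. z \<in> X \<Longrightarrow> f x \<le> f z"
    using x y by (auto simp: is_arg_min_linorder)
  then have m: "m \<in> X"
    using convexD[OF X xy(1,2), of "1/2" "1/2"] by (simp add: m_def scaleR_add_right)
  obtain h where h: "h \<in> subdifferential f m"
    using subgradient_exists[OF f] by blast
  have half: "m - y = x - m"
    unfolding m_def using scaleR_half_double[of x] scaleR_half_double[of y]
    by (simp add: algebra_simps)
  have "h \<bullet> (m - y) \<ge> M / 2 * (norm (m - y))\<^sup>2"
    by (rule subgradient_at_minimizer_growth[OF f X mono y m h])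
  moreover have "f x \<ge> f m + h \<bullet> (x - m)"
    using h by (simp add: subdifferential_def)
  ultimately have "M / 2 * (norm (m - y))\<^sup>2 \<le> 0"
    using xy(3)[OF m] half by simp
  then have "m = y"
    using \<open>M > 0\<close> by (simp add: mult_le_0_iff)
  then show ?thesis
    using half by simp
qed

section \<open>Absolutely continuous functions on an interval\<close>

text \<open>
  The exceptional null set is covered by an open set of measure below the \<open>\<delta>\<close> of absolute
  continuity. A tagged division fine for a gauge built from this cover and from the
  differentiability radii telescopes \<open>w b - w a\<close>: both kinds of tags contribute little.
\<close>
lemma absolutely_continuous_nonincreasing:
  fixes w :: "real \<Rightarrow> real"
  assumes "a \<le> b" and ac: "absolutely_continuous_on a b w"
    and ae: "AE t in lborel. t \<in> {a..b} \<longrightarrow>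
          (\<exists>D\<le>0. (w has_vector_derivative D) (at t within {a..b}))"
  shows "w b \<le> w a"
proof (rule field_le_epsilon)
  fix e' :: real
  assume "0 < e'"
  \<comment> \<open>Tags outside the null set will contribute at most \<open>e * (b - a)\<close> and
    tags inside it less than \<open>e\<close>; together this stays below \<open>e'\<close>.\<close>
  define e where "e = e' / (b - a + 1)"
  have e: "0 < e" "e * (b - a) + e = e'"
  proof -
    have "e * (b - a + 1) = e'" using \<open>a \<le> b\<close> by (simp add: e_def)
    then show "e * (b - a) + e = e'" by (simp add: algebra_simps)
  qed (use \<open>0 < e'\<close> \<open>a \<le> b\<close> in \<open>simp add: e_def\<close>)
  obtain \<delta> where "\<delta> > 0" and \<delta>: "\<And>D. D division_of \<Union>D \<and> \<Union>D \<subseteq> {a..b} \<and>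
      (\<Sum>K\<in>D. Sup K - Inf K) < \<delta> \<Longrightarrow> (\<Sum>K\<in>D. norm (w (Sup K) - w (Inf K))) < e"
    using ac e(1) unfolding absolutely_continuous_on_def by blast
  obtain N where N: "N \<in> null_sets lborel"
    and "\<And>t. t \<in> space lborel - N \<Longrightarrow> t \<in> {a..b} \<longrightarrow>
          (\<exists>D\<le>0. (w has_vector_derivative D) (at t within {a..b}))"
    by (rule AE_E3[OF ae]) blast
  then have der: "\<exists>D\<le>0. (w has_vector_derivative D) (at t within {a..b})" if "t \<in> {a..b} - N" for t
    using that by simp
  have "N \<in> sets borel"
    using N by (simp add: null_sets_def)
  then obtain U where U: "open U" "N \<subseteq> U" "emeasure lborel (U - N) < \<delta>"
    using \<open>\<delta> > 0\<close> by (rule outer_regular_lborel)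
  have "emeasure lborel U = emeasure lborel (U - N)"
    using N U(1) by (simp add: emeasure_Diff_null_set)
  with U(3) have mU: "emeasure lborel U < \<delta>" by simp
  \<comment> \<open>First-order expansion over an interval straddling \<open>t\<close>: the errors
    at \<open>u\<close> and \<open>v\<close> add up to at most \<open>e * (v - u)\<close>, and the
    linear part \<open>(v - u) * D\<close> is nonpositive.\<close>
  have "\<exists>d>0. t \<in> {a..b} - N \<longrightarrow> (\<forall>u v. a \<le> u \<and> u \<le> t \<and> t \<le> v \<and> v \<le> b \<and> u \<in> ball t d \<and> v \<in> ball t d
      \<longrightarrow> w v - w u \<le> e * (v - u))" for t
  proof (cases "t \<in> {a..b} - N")
    case True
    then obtain D where "D \<le> 0" "(w has_vector_derivative D) (at t within {a..b})"
      using der by blast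
    then obtain d where "d > 0"
      and d: "\<And>y. y \<in> {a..b} \<Longrightarrow> \<bar>y - t\<bar> < d \<Longrightarrow> \<bar>w y - w t - (y - t) * D\<bar> \<le> e * \<bar>y - t\<bar>"
      using e(1) unfolding has_vector_derivative_def has_derivative_within_alt by force
    have "w v - w u \<le> e * (v - u)"
      if "a \<le> u" "u \<le> t" "t \<le> v" "v \<le> b" "u \<in> ball t d" "v \<in> ball t d" for u v
    proof -
      have "\<bar>w v - w t - (v - t) * D\<bar> \<le> e * (v - t)"
        using d[of v] that by (simp add: dist_real_def)
      moreover have "\<bar>w u - w t - (u - t) * D\<bar> \<le> e * (t - u)"
        using d[of u] that by (simp add: dist_real_def)
      moreover have "(v - u) * D \<le> 0"
        using \<open>D \<le> 0\<close> that by (simp add: mult_nonneg_nonpos)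
      ultimately show ?thesis by (simp add: algebra_simps)
    qed
    with \<open>d > 0\<close> show ?thesis by blast
  qed (auto intro: exI[of _ 1])
  then obtain d where d0: "\<And>t. d t > 0"
    and d: "\<And>t u v. \<lbrakk>t \<in> {a..b} - N; a \<le> u; u \<le> t; t \<le> v; v \<le> b; u \<in> ball t (d t); v \<in> ball t (d t)\<rbrakk>
      \<Longrightarrow> w v - w u \<le> e * (v - u)"
    by metis
  define \<gamma> where "\<gamma> t = (if t \<in> N then U else ball t (d t))" for t
  have "gauge \<gamma>"
    using U d0 by (auto simp: gauge_def \<gamma>_def)
  then obtain p where p: "p tagged_division_of {a..b}" "\<gamma> fine p"
    by (rule fine_division_exists_real)
  define q where "q = {z \<in> p. fst z \<in> N}"
  have q: "q tagged_partial_division_of {a..b}"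
    using p(1) tagged_partial_division_subset[of p "{a..b}" q] unfolding tagged_division_of_def q_def
    by blast
  define \<D> where "\<D> = snd ` q"
  have \<D>: "\<D> division_of \<Union>\<D>" "\<Union>\<D> \<subseteq> {a..b}"
    using partial_division_of_tagged_division[OF q] tagged_partial_division_ofD(3)[OF q]
    by (fastforce simp: \<D>_def)+
  have "\<Union>\<D> \<subseteq> U"
    using p(2) by (force simp: \<D>_def q_def \<gamma>_def fine_def)
  have int: "\<exists>u v. K = {u..v} \<and> a \<le> u \<and> u \<le> x \<and> x \<le> v \<and> v \<le> b" if "(x, K) \<in> p" for x K
    using tagged_division_ofD(2,3,4)[OF p(1) that] by fastforce
  have \<D>_short: "(\<Sum>K\<in>\<D>. Sup K - Inf K) < \<delta>"
  proof -
    \<comment> \<open>Intervals of a division overlap only in null sets, so their lengths add up to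
      the measure of their union, which lies in \<open>U\<close>.\<close>
    have "(\<Sum>K\<in>\<D>. Sup K - Inf K) = (\<Sum>K\<in>\<D>. measure lebesgue K)"
    proof (rule sum.cong)
      fix K assume "K \<in> \<D>"
      then obtain x where "(x, K) \<in> p" by (auto simp: \<D>_def q_def)
      from int[OF this] show "Sup K - Inf K = measure lebesgue K" by auto
    qed simp
    also have "\<dots> = measure lebesgue (\<Union>\<D>)"
      by (rule content_division[OF \<D>(1)])
    also have "ennreal \<dots> = emeasure lebesgue (\<Union>\<D>)"
      using lmeasurable_division[OF \<D>(1)] by (simp add: emeasure_eq_measure2)
    also have "\<dots> \<le> emeasure lebesgue U"
      using \<open>\<Union>\<D> \<subseteq> U\<close> U(1) by (intro emeasure_mono) auto
    also have "\<dots> < \<delta>"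
      using mU U(1) by simp
    finally show ?thesis
      by (meson ennreal_leI linorder_not_less)
  qed
  have "(\<Sum>(x, K)\<in>q. norm (w (Sup K) - w (Inf K))) = (\<Sum>K\<in>\<D>. norm (w (Sup K) - w (Inf K)))"
  proof -
    \<comment> \<open>Several tags can share an interval only if it is degenerate, so both sums
      agree for a function vanishing on intervals with empty interior. Setting \<open>h\<close> to 0
      on the empty set provides this, since \<open>Sup\<close> and \<open>Inf\<close> are
      unspecified there.\<close>
    define h where "h K = (if K = {} then 0 else norm (w (Sup K) - w (Inf K)))" for K
    have ne: "K \<noteq> {}" if "(x, K) \<in> q" for x K
      using tagged_partial_division_ofD(2)[OF q that] by auto
    have "(\<Sum>(x, K)\<in>q. h K) = (\<Sum>K\<in>\<D>. h K)"
      unfolding \<D>_def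
      by (rule sum.over_tagged_division_lemma[OF tagged_partial_division_of_Union_self[OF q]])
        (auto simp: h_def)
    moreover have "(\<Sum>(x, K)\<in>q. h K) = (\<Sum>(x, K)\<in>q. norm (w (Sup K) - w (Inf K)))"
      by (rule sum.cong) (use ne in \<open>auto simp: h_def\<close>)
    moreover have "(\<Sum>K\<in>\<D>. h K) = (\<Sum>K\<in>\<D>. norm (w (Sup K) - w (Inf K)))"
      by (rule sum.cong) (use ne in \<open>auto simp: h_def \<D>_def\<close>)
    ultimately show ?thesis by simp
  qed
  then have small: "(\<Sum>(x, K)\<in>q. norm (w (Sup K) - w (Inf K))) < e"
    using \<delta>[of \<D>] \<D> \<D>_short by simp
  have fin: "finite p" using p(1) by blast
  have "w b - w a = (\<Sum>(x, K)\<in>p. w (Sup K) - w (Inf K))"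
    using additive_tagged_division_1[OF \<open>a \<le> b\<close> p(1)] by metis
  \<comment> \<open>For a tag outside \<open>N\<close> the first summand suffices; for a tag in
    \<open>N\<close> the second does, the first being nonnegative.\<close>
  also have "\<dots> \<le> (\<Sum>z\<in>p. e * (case z of (x, K) \<Rightarrow> Sup K - Inf K) +
      (if fst z \<in> N then (case z of (x, K) \<Rightarrow> norm (w (Sup K) - w (Inf K))) else 0))"
  proof (rule sum_mono, clarify)
    fix x K assume xK: "(x, K) \<in> p"
    from int[OF this] obtain u v where K: "K = {u..v}" "a \<le> u" "u \<le> x" "x \<le> v" "v \<le> b" by blast
    then have SI: "Sup K = v" "Inf K = u" by auto
    have "K \<subseteq> \<gamma> x" using p(2) xK by (auto simp: fine_def)
    have "w v - w u \<le> e * (v - u)" if "x \<notin> N"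
    proof (rule d)
      show "u \<in> ball x (d x)" "v \<in> ball x (d x)"
        using subsetD[OF \<open>K \<subseteq> \<gamma> x\<close>] K that by (auto simp: \<gamma>_def)
    qed (use K that in auto)
    moreover have "0 \<le> e * (v - u)" using e K by simp
    ultimately show "w (Sup K) - w (Inf K) \<le> e * (Sup K - Inf K) +
      (if fst (x, K) \<in> N then norm (w (Sup K) - w (Inf K)) else 0)"
      unfolding SI by auto
  qed
  also have "\<dots> = e * (\<Sum>(x, K)\<in>p. Sup K - Inf K) + (\<Sum>(x, K)\<in>q. norm (w (Sup K) - w (Inf K)))"
    unfolding q_def sum.inter_filter[OF fin] by (simp add: sum.distrib sum_distrib_left)
  also have "(\<Sum>(x, K)\<in>p. Sup K - Inf K) = b - a"
    using additive_tagged_division_1[OF \<open>a \<le> b\<close> p(1), of "\<lambda>x. x"] by simp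
  finally show "w b \<le> w a + e'"
    using small e(2) by simp
qed

text \<open>The extra increment \<open>v - u\<close> admits functions that depend on time explicitly
  as well as through \<open>x\<close>, such as an exponential weight times a function of the
  state.\<close>

lemma absolutely_continuous_on_lipschitz_image:
  fixes x :: "real \<Rightarrow> 'a::real_normed_vector" and w :: "real \<Rightarrow> 'b::real_normed_vector"
  assumes ac: "absolutely_continuous_on a b x" and "L \<ge> 0"
    and lip: "\<And>u v. \<lbrakk>a \<le> u; u \<le> v; v \<le> b\<rbrakk> \<Longrightarrow> norm (w v - w u) \<le> L * (norm (x v - x u) + (v - u))"
  shows "absolutely_continuous_on a b w"
  unfolding absolutely_continuous_on_def
proof (intro allI impI)
  fix e :: real
  assume "e > 0"
  \<comment> \<open>Using \<open>L + 1\<close> in place of \<open>L\<close> covers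
    \<open>L = 0\<close> and makes the final inequality strict.\<close>
  define e' where "e' = e / (2 * (L + 1))"
  have "e' > 0" using \<open>e > 0\<close> \<open>L \<ge> 0\<close> by (simp add: e'_def)
  have "e' * (2 * (L + 1)) = e"
    using \<open>L \<ge> 0\<close> by (simp add: e'_def)
  then have e': "L * (e' + e') < e"
    using \<open>e' > 0\<close> by (simp add: algebra_simps)
  obtain \<delta> where "\<delta> > 0" and \<delta>: "\<And>D. D division_of \<Union>D \<and> \<Union>D \<subseteq> {a..b} \<and>
      (\<Sum>K\<in>D. Sup K - Inf K) < \<delta> \<Longrightarrow> (\<Sum>K\<in>D. norm (x (Sup K) - x (Inf K))) < e'"
    using ac \<open>e' > 0\<close> unfolding absolutely_continuous_on_def by blast
  show "\<exists>\<delta>>0. \<forall>D. D division_of \<Union>D \<and> \<Union>D \<subseteq> {a..b} \<and> (\<Sum>K\<in>D. Sup K - Inf K) < \<delta>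
        \<longrightarrow> (\<Sum>K\<in>D. norm (w (Sup K) - w (Inf K))) < e"
  \<comment> \<open>Here \<open>\<delta>\<close> controls the increments of \<open>x\<close>, and
    \<open>e'\<close> controls the total length itself.\<close>
  proof (intro exI[of _ "min \<delta> e'"] conjI allI impI)
    fix D assume D: "D division_of \<Union>D \<and> \<Union>D \<subseteq> {a..b} \<and> (\<Sum>K\<in>D. Sup K - Inf K) < min \<delta> e'"
    have "(\<Sum>K\<in>D. norm (w (Sup K) - w (Inf K)))
        \<le> (\<Sum>K\<in>D. L * (norm (x (Sup K) - x (Inf K)) + (Sup K - Inf K)))"
    proof (rule sum_mono)
      fix K assume K: "K \<in> D"
      obtain u v where uv: "K = {u..v}" "u \<le> v"
        using D K division_ofD(3,4)[of D "\<Union>D" K] by fastforce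
      moreover have "K \<subseteq> {a..b}" using D K by blast
      ultimately show "norm (w (Sup K) - w (Inf K)) \<le> L * (norm (x (Sup K) - x (Inf K)) + (Sup K - Inf K))"
        using lip[of u v] by auto
    qed
    also have "\<dots> = L * ((\<Sum>K\<in>D. norm (x (Sup K) - x (Inf K))) + (\<Sum>K\<in>D. Sup K - Inf K))"
      by (simp add: sum.distrib flip: sum_distrib_left)
    also have "\<dots> \<le> L * (e' + e')"
      using \<delta>[of D] D \<open>L \<ge> 0\<close> by (intro mult_left_mono add_mono) auto
    finally show "(\<Sum>K\<in>D. norm (w (Sup K) - w (Inf K))) < e"
      using e' by linarith
  qed (use \<open>\<delta> > 0\<close> \<open>e' > 0\<close> in simp)
qed

section \<open>Decay of the squared distance along solutions\<close>

text \<open>An integrated Gronwall estimate. Boundedness of \<open>X\<close> makes the squared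
  distance Lipschitz along the solution, so the weighted function \<open>w\<close> inherits absolute
  continuity and the sign of its almost-everywhere derivative decides.\<close>

lemma dissipative_solution_bound:
  fixes x :: "real \<Rightarrow> 'a::euclidean_space"
  assumes sol: "caratheodory_solution \<Phi> X x" and X: "bounded X" and "c > 0" and "C \<ge> 0" and "T \<ge> 0"
    and diss: "\<And>y v. y \<in> X \<Longrightarrow> v \<in> \<Phi> y \<Longrightarrow> 2 * (v \<bullet> (y - z)) \<le> - c * ((norm (y - z))\<^sup>2 - C)"
  shows "(norm (x T - z))\<^sup>2 \<le> exp (- c * T) * (norm (x 0 - z))\<^sup>2 + C"
proof -
  define V where "V t = (norm (x t - z))\<^sup>2" for t
  define w where "w t = exp (c * t) * (V t - C)" for t
  have inX: "x t \<in> X" if "t \<ge> 0" for t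
    using sol that by (auto simp: caratheodory_solution_def)
  obtain B where "B \<ge> 0" and B: "\<And>t. t \<ge> 0 \<Longrightarrow> norm (x t - z) \<le> B"
  proof -
    obtain B0 where B0: "\<And>y. y \<in> X \<Longrightarrow> norm y \<le> B0"
      using X by (auto simp: bounded_iff)
    have "norm (x t - z) \<le> \<bar>B0\<bar> + norm z" if "t \<ge> 0" for t
      using norm_triangle_ineq4[of "x t" z] B0[OF inX[OF that]] by linarith
    then show thesis by (intro that[of "\<bar>B0\<bar> + norm z"]) auto
  qed
  \<comment> \<open>The summand with \<open>2 * B\<close> pays for the variation of
    \<open>V\<close>, the other for that of the exponential, multiplied by the bound on
    \<open>V - C\<close>.\<close>
  define L where "L = exp (c * T) * (2 * B + c * (B\<^sup>2 + C))"
  have V_lip: "\<bar>V v - V u\<bar> \<le> 2 * B * norm (x v - x u)" if "0 \<le> u" "0 \<le> v" for u v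
  proof -
    have "V v - V u = (norm (x v - z) + norm (x u - z)) * (norm (x v - z) - norm (x u - z))"
      by (simp add: V_def power2_eq_square algebra_simps)
    then have "\<bar>V v - V u\<bar> = (norm (x v - z) + norm (x u - z)) * \<bar>norm (x v - z) - norm (x u - z)\<bar>"
      by (simp add: abs_mult)
    also have "\<dots> \<le> (2 * B) * norm (x v - x u)"
      using B[OF that(1)] B[OF that(2)] norm_triangle_ineq3[of "x v - z" "x u - z"] \<open>B \<ge> 0\<close>
      by (intro mult_mono) auto
    finally show ?thesis .
  qed
  have "absolutely_continuous_on 0 T w"
  proof (rule absolutely_continuous_on_lipschitz_image)
    show "absolutely_continuous_on 0 T x"
      using sol \<open>T \<ge> 0\<close> by (auto simp: caratheodory_solution_def)
    show "L \<ge> 0"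
      using \<open>B \<ge> 0\<close> \<open>c > 0\<close> \<open>C \<ge> 0\<close> by (auto simp: L_def)
    fix u v :: real
    assume uv: "0 \<le> u" "u \<le> v" "v \<le> T"
    have "exp (c * v) - exp (c * u) = exp (c * v) * (1 - exp (- (c * (v - u))))"
      by (simp add: algebra_simps flip: exp_add)
    \<comment> \<open>This uses \<open>1 - exp (- s) \<le> s\<close> with
      \<open>s = c * (v - u)\<close>.\<close>
    also have "\<dots> \<le> exp (c * T) * (c * (v - u))"
      using exp_ge_add_one_self[of "- (c * (v - u))"] uv \<open>c > 0\<close> by (intro mult_mono) auto
    finally have exp_lip: "\<bar>exp (c * v) - exp (c * u)\<bar> \<le> exp (c * T) * (c * (v - u))"
      using uv \<open>c > 0\<close> by simp
    have "(norm (x u - z))\<^sup>2 \<le> B\<^sup>2"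
      using B[OF uv(1)] by (intro power_mono) auto
    then have V_bd: "\<bar>V u - C\<bar> \<le> B\<^sup>2 + C"
      using \<open>C \<ge> 0\<close> zero_le_power2[of "norm (x u - z)"] zero_le_power2[of B] unfolding V_def by linarith
    have "w v - w u = exp (c * v) * (V v - V u) + (exp (c * v) - exp (c * u)) * (V u - C)"
      by (simp add: w_def algebra_simps)
    then have "norm (w v - w u) \<le> exp (c * v) * \<bar>V v - V u\<bar> + \<bar>exp (c * v) - exp (c * u)\<bar> * \<bar>V u - C\<bar>"
      using abs_triangle_ineq[of "exp (c * v) * (V v - V u)" "(exp (c * v) - exp (c * u)) * (V u - C)"]
      by (simp add: abs_mult)
    also have "\<dots> \<le> exp (c * T) * (2 * B * norm (x v - x u)) + exp (c * T) * (c * (v - u)) * (B\<^sup>2 + C)"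
      using uv \<open>c > 0\<close> V_lip[of u v] exp_lip V_bd by (intro add_mono mult_mono) auto
    also have "\<dots> = exp (c * T) * (2 * B) * norm (x v - x u) + exp (c * T) * (c * (B\<^sup>2 + C)) * (v - u)"
      by (simp add: algebra_simps)
    also have "\<dots> \<le> L * norm (x v - x u) + L * (v - u)"
      using uv \<open>c > 0\<close> \<open>B \<ge> 0\<close> \<open>C \<ge> 0\<close> unfolding L_def
      by (intro add_mono mult_right_mono mult_left_mono) auto
    finally show "norm (w v - w u) \<le> L * (norm (x v - x u) + (v - u))"
      by (simp add: algebra_simps)
  qed
  moreover have "AE t in lborel. t \<in> {0..T} \<longrightarrow>
      (\<exists>D\<le>0. (w has_vector_derivative D) (at t within {0..T}))"
  proof -
    have "\<exists>D\<le>0. (w has_vector_derivative D) (at t within {0..T})"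
      if t: "t \<in> {0..T}" and v: "v \<in> \<Phi> (x t)" and der: "(x has_vector_derivative v) (at t within {0..})"
      for t v
    proof -
      have "(x has_vector_derivative v) (at t within {0..T})"
        by (rule has_vector_derivative_within_subset[OF der]) auto
      then have "(w has_vector_derivative
          exp (c * t) * (2 * (v \<bullet> (x t - z)) + c * (V t - C))) (at t within {0..T})"
        unfolding w_def V_def power2_norm_eq_inner has_vector_derivative_def
        by (auto intro!: derivative_eq_intros simp: algebra_simps inner_commute)
      moreover have "2 * (v \<bullet> (x t - z)) + c * (V t - C) \<le> 0"
        using diss[OF inX v] t by (simp add: V_def)
      ultimately show ?thesis
        by (meson exp_ge_zero mult_nonneg_nonpos)
    qed
    moreover have "AE t in lborel. t \<ge> 0 \<longrightarrow>
        (\<exists>v\<in>\<Phi> (x t). (x has_vector_derivative v) (at t within {0..}))"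
      using sol by (simp add: caratheodory_solution_def)
    ultimately show ?thesis
      by (auto elim!: eventually_mono)
  qed
  ultimately have "w T \<le> w 0"
    using absolutely_continuous_nonincreasing[OF \<open>T \<ge> 0\<close>] by blast
  have "V T - C = exp (- c * T) * w T"
    by (simp add: w_def exp_minus)
  also have "\<dots> \<le> exp (- c * T) * (V 0 - C)"
    using \<open>w T \<le> w 0\<close> by (intro mult_left_mono) (simp_all add: w_def)
  \<comment> \<open>The discarded term \<open>- exp (- c * T) * C\<close> is nonpositive.\<close>
  also have "\<dots> \<le> exp (- c * T) * V 0"
    using \<open>C \<ge> 0\<close> by (intro mult_left_mono) auto
  finally show ?thesis by (simp add: V_def)
qed

lemma perturbed_field_dissipative:
  assumes growth: "\<And>g. g \<in> subdifferential f y \<Longrightarrow> g \<bullet> (y - z) \<ge> M / 2 * (norm (y - z))\<^sup>2"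
    and "M > 0" and z: "z \<in> X" and v: "v \<in> perturbed_field f G X \<epsilon> y"
  shows "2 * (v \<bullet> (y - z)) \<le> - (M / 2) * ((norm (y - z))\<^sup>2 - (2 * \<epsilon> / M)\<^sup>2)"
proof -
  define r where "r = norm (y - z)"
  obtain g n b where v_eq: "v = - (g + n + b)" and g: "g \<in> subdifferential f y"
    and n: "n \<in> truncated_normal_cone G X y" and b: "norm b \<le> \<epsilon>"
    using v by (auto simp: perturbed_field_def elim!: set_plus_elim)
  \<comment> \<open>The normal cone inequality at \<open>y\<close> is tested with the feasible point
    \<open>z\<close>.\<close>
  have "n \<bullet> (y - z) \<ge> 0"
    using n z by (force simp: truncated_normal_cone_def normal_cone_def inner_diff_right)
  moreover have "- (b \<bullet> (y - z)) \<le> \<epsilon> * r"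
    using Cauchy_Schwarz_ineq2[of b "y - z"] mult_right_mono[OF b, of r] by (simp add: r_def)
  ultimately have "v \<bullet> (y - z) \<le> - (M / 2) * r\<^sup>2 + \<epsilon> * r"
    using growth[OF g] by (simp add: v_eq r_def inner_diff_left inner_add_left)
  \<comment> \<open>Young's inequality as a completed square: half of the decay
    \<open>M * r\<^sup>2\<close> absorbs \<open>2 * \<epsilon> * r\<close>, leaving the rate
    \<open>M / 2\<close> and the residual level \<open>(2 * \<epsilon> / M)\<^sup>2\<close>.\<close>
  moreover have "0 \<le> M / 2 * (r - 2 * \<epsilon> / M)\<^sup>2"
    using \<open>M > 0\<close> by simp
  moreover have "M / 2 * (r - 2 * \<epsilon> / M)\<^sup>2 = M / 2 * r\<^sup>2 + M / 2 * (2 * \<epsilon> / M)\<^sup>2 - 2 * (\<epsilon> * r)"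
    using \<open>M > 0\<close> by (simp add: power2_diff right_diff_distrib distrib_left)
  ultimately show ?thesis
    unfolding r_def[symmetric] right_diff_distrib by linarith
qed

section \<open>Existence of the minimizer and the comparison functions\<close>

theorem proposition3:
  fixes P :: "'w measure" and Z :: "'z measure" and \<zeta> :: "'w \<Rightarrow> 'z"
    and F :: "real ^ 'd \<Rightarrow> 'z \<Rightarrow> real" and f :: "real ^ 'd \<Rightarrow> real"
    and X :: "(real ^ 'd) set" and M G :: real
  assumes "X \<noteq> {}" and "compact X" and "convex X"
    and "prob_space P" and "\<zeta> \<in> P \<rightarrow>\<^sub>M Z"
    and "\<And>x. integrable P (\<lambda>\<omega>. F x (\<zeta> \<omega>))"
    and "\<And>\<omega>. \<omega> \<in> space P \<Longrightarrow> convex_on UNIV (\<lambda>x. F x (\<zeta> \<omega>))"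
    and "\<And>x. f x = (LINT \<omega>|P. F x (\<zeta> \<omega>))"
    and "M > 0"
    and "\<And>x y g h. x \<in> X \<Longrightarrow> y \<in> X \<Longrightarrow> g \<in> subdifferential f x \<Longrightarrow> h \<in> subdifferential f y
           \<Longrightarrow> (g - h) \<bullet> (x - y) \<ge> M * (norm (x - y))\<^sup>2"
    and "G > 0"
  shows "(\<exists>!xs. is_arg_min f (\<lambda>x. x \<in> X) xs) \<and>
         (\<forall>xs. is_arg_min f (\<lambda>x. x \<in> X) xs \<longrightarrow>
            input_to_state_stable (perturbed_field f G X) X xs)"
proof (intro conjI allI impI)
  have conv: "convex_on UNIV f"
    using convex_on_expectation[of P F \<zeta>] assms(6,7,8) by presburger
  \<comment> \<open>A finite convex function on a finite-dimensional space is continuous, so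
    compactness of \<open>X\<close> yields a minimizer.\<close>
  then have "continuous_on X f"
    using convex_on_continuous continuous_on_subset by blast
  then have "\<exists>xs. is_arg_min f (\<lambda>x. x \<in> X) xs"
    using continuous_attains_inf[OF assms(2,1), of f] unfolding is_arg_min_linorder by blast
  then show "\<exists>!xs. is_arg_min f (\<lambda>x. x \<in> X) xs"
    using minimizer_unique[OF conv assms(3) assms(9) assms(10)] by blast
  fix xs
  assume xs: "is_arg_min f (\<lambda>x. x \<in> X) xs"
  then have "xs \<in> X" by (simp add: is_arg_min_linorder)
  have growth: "g \<bullet> (y - xs) \<ge> M / 2 * (norm (y - xs))\<^sup>2"
    if "y \<in> X" "g \<in> subdifferential f y" for y g
    by (rule subgradient_at_minimizer_growth[OF conv assms(3,10) xs that])
  \<comment> \<open>The squared distance decays at rate \<open>M / 2\<close> towards the level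
    \<open>(2 * \<epsilon> / M)\<^sup>2\<close>; square roots halve the rate and give
    \<open>\<gamma>\<close>.\<close>
  define \<beta> where "\<beta> r t = exp (- (M / 4) * t) * r" for r t :: real
  define \<gamma> where "\<gamma> \<epsilon> = 2 * \<epsilon> / M" for \<epsilon> :: real
  have "class_KL \<beta>"
    unfolding class_KL_def
  proof (intro conjI allI impI)
    show "continuous_on ({0..} \<times> {0..}) (\<lambda>(r, t). \<beta> r t)"
      unfolding \<beta>_def case_prod_beta by (intro continuous_intros)
    show "class_K (\<lambda>r. \<beta> r t)" for t
      by (auto simp: class_K_def \<beta>_def strict_mono_on_def intro!: continuous_intros)
    show "antimono_on {0..} (\<beta> r)" if "0 \<le> r" for r
      using that \<open>M > 0\<close> by (auto simp: \<beta>_def monotone_on_def intro!: mult_right_mono)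
    show "(\<beta> r \<longlongrightarrow> 0) at_top" for r
      unfolding \<beta>_def using \<open>M > 0\<close> by real_asymp
  qed
  moreover have "class_K_infinity \<gamma>"
    unfolding class_K_infinity_def
  proof
    show "class_K \<gamma>"
      using \<open>M > 0\<close>
      by (auto simp: class_K_def \<gamma>_def strict_mono_on_def divide_strict_right_mono intro!: continuous_intros)
    show "\<not> bdd_above (\<gamma> ` {0..})"
    proof
      assume "bdd_above (\<gamma> ` {0..})"
      then obtain B where B: "\<And>\<epsilon>. 0 \<le> \<epsilon> \<Longrightarrow> \<gamma> \<epsilon> \<le> B"
        by (auto simp: bdd_above_def)
      from B[of "M * (\<bar>B\<bar> + 1)"] \<open>M > 0\<close> show False by (simp add: \<gamma>_def)
    qed
  qed
  moreover have "norm (x t - xs) \<le> \<beta> (norm (x 0 - xs)) t + \<gamma> \<epsilon>"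
    if "\<epsilon> \<ge> 0" "caratheodory_solution (perturbed_field f G X \<epsilon>) X x" "t \<ge> 0" for \<epsilon> x t
  proof (rule power2_le_imp_le)
    have "(norm (x t - xs))\<^sup>2 \<le> exp (- (M / 2) * t) * (norm (x 0 - xs))\<^sup>2 + (\<gamma> \<epsilon>)\<^sup>2"
      unfolding \<gamma>_def
    proof (rule dissipative_solution_bound[OF that(2) compact_imp_bounded[OF assms(2)]])
      show "2 * (v \<bullet> (y - xs)) \<le> - (M / 2) * ((norm (y - xs))\<^sup>2 - (2 * \<epsilon> / M)\<^sup>2)"
        if "y \<in> X" "v \<in> perturbed_field f G X \<epsilon> y" for y v
        using perturbed_field_dissipative[OF growth[OF that(1)] \<open>M > 0\<close> \<open>xs \<in> X\<close> that(2)] .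
    qed (use \<open>M > 0\<close> that in auto)
    also have "exp (- (M / 2) * t) = (exp (- (M / 4) * t))\<^sup>2"
      by (simp add: power2_eq_square flip: exp_add)
    also have "\<dots> * (norm (x 0 - xs))\<^sup>2 = (\<beta> (norm (x 0 - xs)) t)\<^sup>2"
      by (simp add: \<beta>_def power_mult_distrib)
    \<comment> \<open>The cross term is nonnegative; this is the subadditivity of the square
      root.\<close>
    also have "(\<beta> (norm (x 0 - xs)) t)\<^sup>2 + (\<gamma> \<epsilon>)\<^sup>2 \<le> (\<beta> (norm (x 0 - xs)) t + \<gamma> \<epsilon>)\<^sup>2"
      using that \<open>M > 0\<close> by (simp add: power2_sum \<beta>_def \<gamma>_def)
    finally show "(norm (x t - xs))\<^sup>2 \<le> (\<beta> (norm (x 0 - xs)) t + \<gamma> \<epsilon>)\<^sup>2" .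
    show "0 \<le> \<beta> (norm (x 0 - xs)) t + \<gamma> \<epsilon>"
      using that \<open>M > 0\<close> by (simp add: \<beta>_def \<gamma>_def)
  qed
  ultimately show "input_to_state_stable (perturbed_field f G X) X xs"
    unfolding input_to_state_stable_def by blast
qed

end
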